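(* Let $G=(V,E,w)$ be a connected graph and let $\pi\in\mathscr{P}(V)$ be the stationary distribution of the simple random walk on $V$, whose transition matrix is $P=D_w^{-1}A_w$. Let $$\chi^2(\mu)=\frac{1}{2\,\mathrm{Vol}_w(G)}\sum_{x\in V}\frac{(\mu(x)-\pi(x))^2}{\pi(x)}.$$ Then, on $\mathscr{P}_\star(V)$, the gradient flow of $\chi^2$ with respect to the Riemannian metric tensor induced by the inner product $\langle f,g\rangle_{L_w^\dagger}=f^\top L_w^\dagger g$ on $\mathbb{R}^V_0$ coincides with the continuous time evolution of the random walk; i.e. the gradient flow equation $\frac{d}{dt}\rho_t=-\nabla\chi^2(\rho_t)$ on $\mathscr{P}_\star(V)$ is $$\frac{d}{dt}\rho_t=(P^\top-\mathrm{Id})\rho_t.$$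
   Context: A graph $G=(V,E,w)$ consists of a finite vertex set $V$, a set $E$ of $m\ge 1$ undirected edges (unordered pairs of distinct vertices), and positive edge weights $w=(w_{xy})_{\{x,y\}\in E}$ (with $w_{xy}=w_{yx}$). Write $y\sim x$ if $\{x,y\}\in E$. The degree of $x$ is $\mathrm{d}_x=\sum_{y\sim x}w_{xy}$; $D_w$ is the diagonal degree matrix, $A_w$ the weighted adjacency matrix, $L_w=D_w-A_w$ the Laplacian matrix, and $\mathrm{Vol}_w(G)=\sum_{x\in V}\mathrm{d}_x$. For connected $G$ the unique stationary distribution of $P$ is $\pi(x)=\mathrm{d}_x/\mathrm{Vol}_w(G)$. $X^\dagger$ denotes the Moore--Penrose inverse. $\mathscr{P}(V)$ is the simplex of probability densities on $V$, viewed as column vectors in $\mathbb{R}^V$, and $\mathscr{P}_\star(V)$ is its interior (everywhere positive densities), an open subset of the affine hyperplane $\{\rho\in\mathbb{R}^V:\sum_x\rho(x)=1\}$ with tangent space $\mathbb{R}^V_0=\{f\in\mathbb{R}^V:\sum_xf(x)=0\}$ at each point. For a $\mathcal{C}^1$ functional $F:\mathscr{P}_\star(V)\to\mathbb{R}$, the Riemannian gradient $\nabla F(\rho)\in\mathbb{R}^V_0$ is the unique vector with $\partial F(\rho)[f]=f^\top L_w^\dagger\nabla F(\rho)$ for all $f\in\mathbb{R}^V_0$, where $\partial F(\rho)[f]$ is the directional derivative of $F$ at $\rho$ in direction $f$. For an interval $J\subseteq\mathbb{R}$, a $\mathcal{C}^1$ curve $(\rho_t)_{t\in J}\subseteq\mathscr{P}_\star(V)$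 is a gradient flow trajectory of $F$ if $\frac{d}{dt}\rho_t=-\nabla F(\rho_t)$ for $t\in J$. The continuous time evolution of the random walk is the forward equation $\frac{d}{dt}\rho_t=(P^\top-\mathrm{Id})\rho_t$, where $\mathrm{Id}$ is the identity matrix. *)

theory Defs
  imports "HOL-Analysis.Analysis"
begin

(* The vertex set V is the finite type 'v, so R^V is real^'v.  An edge is an unordered
   pair {x,y} with x \<noteq> y, and the weight w_xy is w {x,y}; values of w off E are never used. *)

definition weighted_graph :: "'v::finite set set \<Rightarrow> ('v set \<Rightarrow> real) \<Rightarrow> bool" where
  "weighted_graph E w \<longleftrightarrow> E \<noteq> {} \<and> (\<forall>e\<in>E. card e = 2) \<and> (\<forall>e\<in>E. w e > 0)"

definition connected_graph :: "'v::finite set set \<Rightarrow> bool" where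
  "connected_graph E \<longleftrightarrow> (\<forall>x y. (x, y) \<in> {(a, b). {a, b} \<in> E}\<^sup>*)"

definition degree :: "'v::finite set set \<Rightarrow> ('v set \<Rightarrow> real) \<Rightarrow> 'v \<Rightarrow> real" where
  "degree E w x = (\<Sum>y | {x, y} \<in> E. w {x, y})"

definition Vol :: "'v::finite set set \<Rightarrow> ('v set \<Rightarrow> real) \<Rightarrow> real" where
  "Vol E w = (\<Sum>x\<in>UNIV. degree E w x)"

definition degree_matrix :: "'v::finite set set \<Rightarrow> ('v set \<Rightarrow> real) \<Rightarrow> real^'v^'v" where
  "degree_matrix E w = (\<chi> x y. if x = y then degree E w x else 0)"

definition adjacency_matrix :: "'v::finite set set \<Rightarrow> ('v set \<Rightarrow> real) \<Rightarrow> real^'v^'v" where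
  "adjacency_matrix E w = (\<chi> x y. if {x, y} \<in> E then w {x, y} else 0)"

definition laplacian :: "'v::finite set set \<Rightarrow> ('v set \<Rightarrow> real) \<Rightarrow> real^'v^'v" where
  "laplacian E w = degree_matrix E w - adjacency_matrix E w"

definition transition_matrix :: "'v::finite set set \<Rightarrow> ('v set \<Rightarrow> real) \<Rightarrow> real^'v^'v" where
  "transition_matrix E w = matrix_inv (degree_matrix E w) ** adjacency_matrix E w"

(* The four Penrose equations, which determine X uniquely. *)
definition is_moore_penrose :: "real^'n^'m \<Rightarrow> real^'m^'n \<Rightarrow> bool" where
  "is_moore_penrose A X \<longleftrightarrow>
     A ** X ** A = A \<and> X ** A ** X = X \<and>
     transpose (A ** X) = A ** X \<and> transpose (X ** A) = X ** A"

definition pinv :: "real^'n^'m \<Rightarrow> real^'m^'n" where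
  "pinv A = (THE X. is_moore_penrose A X)"

definition prob_simplex :: "(real^'v::finite) set" where
  "prob_simplex = {\<rho>. (\<forall>x. \<rho> $ x \<ge> 0) \<and> (\<Sum>x\<in>UNIV. \<rho> $ x) = 1}"

definition pos_simplex :: "(real^'v::finite) set" where
  "pos_simplex = {\<rho>\<in>prob_simplex. \<forall>x. \<rho> $ x > 0}"

definition zero_sum :: "(real^'v::finite) set" where
  "zero_sum = {f. (\<Sum>x\<in>UNIV. f $ x) = 0}"

definition stationary_distribution :: "real^'v::finite^'v \<Rightarrow> real^'v \<Rightarrow> bool" where
  "stationary_distribution P p \<longleftrightarrow> p \<in> prob_simplex \<and> p v* P = p"

definition pinv_inner ::
    "'v::finite set set \<Rightarrow> ('v set \<Rightarrow> real) \<Rightarrow> real^'v \<Rightarrow> real^'v \<Rightarrow> real" where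
  "pinv_inner E w f g = f \<bullet> (pinv (laplacian E w) *v g)"

(* F is a function on all of R^V, but for \<rho> in pos_simplex and f in zero_sum the point
   \<rho> + t f stays in pos_simplex for small t, so only the values of F there matter. *)
definition riem_gradient ::
    "'v::finite set set \<Rightarrow> ('v set \<Rightarrow> real) \<Rightarrow> (real^'v \<Rightarrow> real) \<Rightarrow> real^'v \<Rightarrow> real^'v" where
  "riem_gradient E w F \<rho> =
     (THE g. g \<in> zero_sum \<and>
        (\<forall>f\<in>zero_sum.
           ((\<lambda>t. F (\<rho> + t *\<^sub>R f)) has_real_derivative pinv_inner E w f g) (at 0)))"

(* Derivatives are taken within J, hence are one-sided at endpoints belonging to J;
   C1_differentiable_on of the library would use two-sided derivatives there. *)
definition C1_curve_on :: "real set \<Rightarrow> (real \<Rightarrow> real^'v::finite) \<Rightarrow> bool" where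
  "C1_curve_on J \<rho> \<longleftrightarrow>
     (\<exists>\<rho>'. (\<forall>t\<in>J. (\<rho> has_vector_derivative \<rho>' t) (at t within J)) \<and> continuous_on J \<rho>')"

definition gradient_flow_trajectory ::
    "'v::finite set set \<Rightarrow> ('v set \<Rightarrow> real) \<Rightarrow> (real^'v \<Rightarrow> real) \<Rightarrow>
     real set \<Rightarrow> (real \<Rightarrow> real^'v) \<Rightarrow> bool" where
  "gradient_flow_trajectory E w F J \<rho> \<longleftrightarrow>
     \<rho> ` J \<subseteq> pos_simplex \<and> C1_curve_on J \<rho> \<and>
     (\<forall>t\<in>J. (\<rho> has_vector_derivative - riem_gradient E w F (\<rho> t)) (at t within J))"

definition chi2 ::
    "'v::finite set set \<Rightarrow> ('v set \<Rightarrow> real) \<Rightarrow> real^'v \<Rightarrow> real^'v \<Rightarrow> real" where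
  "chi2 E w p \<mu> = 1 / (2 * Vol E w) * (\<Sum>x\<in>UNIV. (\<mu> $ x - p $ x)\<^sup>2 / p $ x)"

end

theory Submission
  imports Defs
begin

text \<open>A stationary distribution \<open>p\<close> makes \<open>D\<^sup>-\<^sup>1 p\<close> harmonic, hence constant by the maximum
  principle, so \<open>p x = degree x / Vol\<close>.  Along zero-sum directions the differential of \<open>\<chi>\<^sup>2\<close>
  at \<open>\<rho>\<close> is therefore \<open>f \<mapsto> f \<bullet> D\<^sup>-\<^sup>1 \<rho>\<close>.  Since \<open>L\<^sup>\<dagger> L\<close> is the orthogonal projection onto the
  zero-sum vectors, the gradient is \<open>L D\<^sup>-\<^sup>1 \<rho> = (1 - P\<^sup>T) \<rho>\<close>.\<close>

section \<open>Matrix algebra and uniqueness of the pseudoinverse\<close>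

text \<open>Since \<open>A Y A = A\<close>, the product \<open>A X\<close> equals
  \<open>(A Y) (A X)\<close>; transposing swaps the two symmetric factors, and
  \<open>A X A = A\<close> collapses the result to \<open>A Y\<close>. The same works on the other
  side, so \<open>X = X A X = Y A Y = Y\<close>.\<close>

lemma is_moore_penrose_unique:
  assumes X: "is_moore_penrose A X" and Y: "is_moore_penrose A Y"
  shows "X = Y"
proof -
  note X' = X[unfolded is_moore_penrose_def] and Y' = Y[unfolded is_moore_penrose_def]
  have "A ** X = transpose (A ** X)" using X' by simp
  also have "\<dots> = transpose ((A ** Y) ** (A ** X))"
    using Y' by (metis matrix_mul_assoc)
  also have "\<dots> = A ** X ** (A ** Y)"
    using X' Y' by (simp add: matrix_transpose_mul)
  also have "\<dots> = A ** Y" using X' by (metis matrix_mul_assoc)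
  finally have l: "A ** X = A ** Y" .
  have "X ** A = transpose (X ** A)" using X' by simp
  also have "\<dots> = transpose ((X ** A) ** (Y ** A))"
    using Y' by (metis matrix_mul_assoc)
  also have "\<dots> = Y ** A ** (X ** A)"
    using X' Y' by (simp add: matrix_transpose_mul)
  also have "\<dots> = Y ** A" using X' by (metis matrix_mul_assoc)
  finally have r: "X ** A = Y ** A" .
  show ?thesis using X' Y' l r by (metis matrix_mul_assoc)
qed

lemma pinv_eqI: "is_moore_penrose A X \<Longrightarrow> pinv A = X"
  unfolding pinv_def by (blast intro: is_moore_penrose_unique)

lemma matrix_add_rdistrib:
  fixes A B :: "'a::semiring_1^'n^'m"
  shows "(A + B) ** C = A ** C + B ** C"
  by (simp add: vec_eq_iff matrix_matrix_mult_def distrib_right sum.distrib)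

lemma matrix_diff_ldistrib:
  fixes B C :: "'a::ring_1^'n^'m"
  shows "A ** (B - C) = A ** B - A ** C"
  by (simp add: vec_eq_iff matrix_matrix_mult_def right_diff_distrib sum_subtractf)

lemma matrix_diff_rdistrib:
  fixes A B :: "'a::ring_1^'n^'m"
  shows "(A - B) ** C = A ** C - B ** C"
  by (simp add: vec_eq_iff matrix_matrix_mult_def left_diff_distrib sum_subtractf)

lemma matrix_inv_eqI:
  assumes "A ** B = mat 1" "B ** A = mat 1"
  shows "matrix_inv A = B"
proof -
  have "A ** matrix_inv A = mat 1 \<and> matrix_inv A ** A = mat 1"
    unfolding matrix_inv_def by (rule someI[of _ B]) (use assms in auto)
  then show ?thesis using assms by (metis matrix_mul_assoc matrix_mul_lid matrix_mul_rid)
qed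

section \<open>The Laplacian and the maximum principle\<close>

lemma degree_eq_sum_adjacency:
  "degree E w x = (\<Sum>y\<in>UNIV. adjacency_matrix E w $ x $ y)"
  unfolding degree_def adjacency_matrix_def by (simp add: sum.If_cases)

lemma adjacency_symmetric:
  "adjacency_matrix E w $ x $ y = adjacency_matrix E w $ y $ x"
  by (simp add: adjacency_matrix_def insert_commute)

lemma adjacency_nonneg:
  "weighted_graph E w \<Longrightarrow> adjacency_matrix E w $ x $ y \<ge> 0"
  by (auto simp: adjacency_matrix_def weighted_graph_def intro: less_imp_le)

lemma adjacency_pos:
  "weighted_graph E w \<Longrightarrow> {x, y} \<in> E \<Longrightarrow> adjacency_matrix E w $ x $ y > 0"
  by (simp add: adjacency_matrix_def weighted_graph_def)

lemma laplacian_symmetric: "transpose (laplacian E w) = laplacian E w"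
  by (auto simp: vec_eq_iff transpose_def laplacian_def degree_matrix_def
      adjacency_symmetric)

lemma degree_matrix_mult_component:
  "(degree_matrix E w *v h) $ x = degree E w x * h $ x"
  by (simp add: degree_matrix_def matrix_vector_mult_def mult_delta_left)

lemma adjacency_matrix_mult_component:
  "(adjacency_matrix E w *v h) $ x = (\<Sum>y\<in>UNIV. adjacency_matrix E w $ x $ y * h $ y)"
  by (simp add: matrix_vector_mult_def)

text \<open>In this difference form every summand is nonnegative at a maximum of \<open>h\<close>,
  which is what the maximum principle needs.\<close>

lemma laplacian_mult_component:
  "(laplacian E w *v h) $ x = (\<Sum>y\<in>UNIV. adjacency_matrix E w $ x $ y * (h $ x - h $ y))"
  unfolding laplacian_def matrix_vector_mult_diff_rdistrib
  by (simp add: degree_matrix_mult_component adjacency_matrix_mult_component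
      degree_eq_sum_adjacency sum_distrib_right right_diff_distrib sum_subtractf)

lemma sum_laplacian_mult: "(\<Sum>x\<in>UNIV. (laplacian E w *v h) $ x) = 0"
proof -
  have "vec 1 \<bullet> (laplacian E w *v h) = (laplacian E w *v vec 1) \<bullet> h"
    by (metis dot_lmul_matrix laplacian_symmetric transpose_matrix_vector)
  also have "laplacian E w *v vec 1 = 0"
    by (simp add: vec_eq_iff laplacian_mult_component)
  finally show ?thesis by (simp add: inner_vec_def)
qed

text \<open>At a vertex where \<open>h\<close> is maximal, nonnegative terms sum to zero, so each
  neighbour, joined by a positive weight, is maximal too. Connectedness carries the maximum to all
  vertices.\<close>

lemma harmonic_imp_constant:
  assumes G: "weighted_graph E w" "connected_graph E"
    and h: "laplacian E w *v h = 0"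
  shows "h $ x = h $ y"
proof -
  have "Max (range (($) h)) \<in> range (($) h)" by (intro Max_in) auto
  then obtain z where "Max (range (($) h)) = h $ z" by (rule imageE)
  then have le: "h $ a \<le> h $ z" for a using Max_ge[of "range (($) h)" "h $ a"] by simp
  have eq_step: "h $ b = h $ z" if a: "h $ a = h $ z" and e: "{a, b} \<in> E" for a b
  proof -
    have "(\<Sum>y\<in>UNIV. adjacency_matrix E w $ a $ y * (h $ a - h $ y)) = 0"
      using h laplacian_mult_component[of E w h a] by simp
    moreover have "adjacency_matrix E w $ a $ y * (h $ a - h $ y) \<ge> 0" for y
      using adjacency_nonneg[OF G(1), of a y] le[of y] a by simp
    ultimately have "adjacency_matrix E w $ a $ b * (h $ a - h $ b) = 0"
      by (simp add: sum_nonneg_eq_0_iff)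
    then show ?thesis using adjacency_pos[OF G(1) e] a by simp
  qed
  have eq: "h $ a = h $ z" for a
  proof -
    have "(z, a) \<in> {(a, b). {a, b} \<in> E}\<^sup>*" using G(2) by (simp add: connected_graph_def)
    then show ?thesis
    proof (induction rule: rtrancl_induct)
      case base
      show ?case ..
    next
      case (step b c)
      then show ?case using eq_step by blast
    qed
  qed
  show ?thesis by (rule trans[OF eq eq[symmetric]])
qed

text \<open>The existence of an edge guarantees a second vertex, and a path from \<open>x\<close> to
  it must begin with an edge at \<open>x\<close>.\<close>

lemma degree_pos:
  assumes "weighted_graph E w" "connected_graph E"
  shows "degree E w x > 0"
proof -
  obtain e where "e \<in> E" "card e = 2"
    using assms(1) by (auto simp: weighted_graph_def)
  then obtain a b where ab: "{a, b} \<in> E" "a \<noteq> b" by (auto simp: card_2_iff)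
  then obtain y where "y \<noteq> x" by metis
  have "(x, y) \<in> {(a, b). {a, b} \<in> E}\<^sup>*" using assms(2) by (simp add: connected_graph_def)
  then obtain z where "{x, z} \<in> E" using \<open>y \<noteq> x\<close> by (auto elim: converse_rtranclE)
  then have "0 < (\<Sum>y\<in>UNIV. adjacency_matrix E w $ x $ y)"
    using adjacency_pos[OF assms(1)] adjacency_nonneg[OF assms(1)]
    by (intro sum_pos2[of _ z]) auto
  then show ?thesis by (simp add: degree_eq_sum_adjacency)
qed

lemma Vol_pos: "weighted_graph E w \<Longrightarrow> connected_graph E \<Longrightarrow> Vol E w > 0"
  unfolding Vol_def by (intro sum_pos) (auto simp: degree_pos)

section \<open>The pseudoinverse of the Laplacian\<close>

definition ones_matrix :: "real^'n^'n" where
  "ones_matrix = (\<chi> i j. 1)"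

lemma ones_matrix_mult_component: "(ones_matrix *v x) $ i = (\<Sum>j\<in>UNIV. x $ j)"
  by (simp add: ones_matrix_def matrix_vector_mult_def)

lemma transpose_ones_matrix: "transpose ones_matrix = ones_matrix"
  by (simp add: vec_eq_iff transpose_def ones_matrix_def)

lemma laplacian_mult_ones: "laplacian E w ** ones_matrix = 0"
  by (simp add: matrix_eq matrix_vector_mul_assoc[symmetric] vec_eq_iff
      laplacian_mult_component ones_matrix_mult_component)

lemma ones_mult_laplacian: "ones_matrix ** laplacian E w = 0"
  by (simp add: matrix_eq matrix_vector_mul_assoc[symmetric] vec_eq_iff
      sum_laplacian_mult ones_matrix_mult_component)

text \<open>The kernel is trivial: summing the coordinates of \<open>(L + J) x = 0\<close> removes
  the Laplacian part and forces \<open>x\<close> to have sum zero. Then \<open>x\<close> is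
  harmonic, hence constant, hence zero.\<close>

lemma laplacian_plus_ones_invertible:
  fixes E :: "'v::finite set set"
  assumes "weighted_graph E w" "connected_graph E"
  shows "invertible (laplacian E w + ones_matrix)"
proof -
  have "x = 0" if x: "(laplacian E w + ones_matrix) *v x = 0" for x
  proof -
    have eq: "(laplacian E w *v x) $ i + (\<Sum>j\<in>UNIV. x $ j) = 0" for i
      using arg_cong[OF x, of "\<lambda>v. v $ i"]
      by (simp add: matrix_vector_mult_add_rdistrib ones_matrix_mult_component)
    have "(\<Sum>i\<in>UNIV. (laplacian E w *v x) $ i + (\<Sum>j\<in>UNIV. x $ j)) = 0"
      unfolding eq by simp
    then have s: "(\<Sum>j\<in>UNIV. x $ j) = 0"
      by (simp add: sum.distrib sum_laplacian_mult)
    then have "laplacian E w *v x = 0" using eq by (simp add: vec_eq_iff)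
    then have c: "x $ i = x $ j" for i j using harmonic_imp_constant[OF assms] by blast
    have "x $ i = 0" for i
    proof -
      have "(\<Sum>j\<in>UNIV. x $ j) = (\<Sum>j\<in>(UNIV :: 'v set). x $ i)"
        by (intro sum.cong refl c)
      then show ?thesis using s by simp
    qed
    then show ?thesis by (simp add: vec_eq_iff)
  qed
  then show ?thesis
    by (simp add: invertible_left_inverse matrix_left_invertible_ker)
qed

text \<open>The witness is \<open>(L + J)\<^sup>-\<^sup>1 - J / n\<^sup>2\<close>, where \<open>J\<close> is the all-ones matrix: adding \<open>J\<close> makes
  \<open>L\<close> invertible on its kernel, the constants, without changing it on zero-sum vectors.\<close>

lemma pinv_laplacian:
  fixes E :: "'v::finite set set"
  assumes "weighted_graph E w" "connected_graph E"
  shows "laplacian E w ** pinv (laplacian E w) = mat 1 - (1 / CARD('v)) *\<^sub>R ones_matrix"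
    and "pinv (laplacian E w) ** laplacian E w = mat 1 - (1 / CARD('v)) *\<^sub>R ones_matrix"
proof -
  let ?L = "laplacian E w" and ?J = "ones_matrix :: real^'v^'v" and ?n = "real CARD('v)"
  let ?Q = "mat 1 - (1 / ?n) *\<^sub>R ?J"
  obtain N where N: "(?L + ?J) ** N = mat 1" "N ** (?L + ?J) = mat 1"
    using laplacian_plus_ones_invertible[OF assms] by (auto simp: invertible_def)
  have JJ: "?J ** ?J = ?n *\<^sub>R ?J"
    by (simp add: vec_eq_iff matrix_matrix_mult_def ones_matrix_def)
  have MJ: "(?L + ?J) ** ?J = ?n *\<^sub>R ?J" "?J ** (?L + ?J) = ?n *\<^sub>R ?J"
    by (simp_all add: matrix_add_rdistrib matrix_add_ldistrib laplacian_mult_ones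
        ones_mult_laplacian JJ)
  \<comment> \<open>\<open>L + J\<close> acts on constants as multiplication by \<open>n\<close>, so
    its inverse \<open>N\<close> acts there as division by \<open>n\<close>.\<close>
  have "?n *\<^sub>R (N ** ?J) = N ** ((?L + ?J) ** ?J)"
    by (simp only: MJ matrix_scalar_ac scalar_matrix_assoc)
  also have "\<dots> = ?J" by (simp add: matrix_mul_assoc N)
  finally have NJ: "N ** ?J = (1 / ?n) *\<^sub>R ?J"
    by (simp add: eq_vector_fraction_iff)
  have "?n *\<^sub>R (?J ** N) = (?J ** (?L + ?J)) ** N"
    by (simp only: MJ scalar_matrix_assoc)
  also have "\<dots> = ?J" by (simp add: matrix_mul_assoc[symmetric] N)
  finally have JN: "?J ** N = (1 / ?n) *\<^sub>R ?J"
    by (simp add: eq_vector_fraction_iff)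
  \<comment> \<open>On constants both \<open>N\<close> and \<open>J / n\<^sup>2\<close> act as
    division by \<open>n\<close>; the coefficient is chosen so that \<open>X\<close> annihilates
    constants.\<close>
  define X where "X = N - (1 / ?n\<^sup>2) *\<^sub>R ?J"
  have LN: "?L ** N = ?Q" "N ** ?L = ?Q"
    using N by (simp_all add: matrix_add_rdistrib matrix_add_ldistrib JN NJ eq_diff_eq)
  have LX: "?L ** X = ?Q"
    by (simp add: X_def matrix_diff_ldistrib matrix_scalar_ac
        scalar_matrix_assoc[symmetric] laplacian_mult_ones LN)
  have XL: "X ** ?L = ?Q"
    by (simp add: X_def matrix_diff_rdistrib scalar_matrix_assoc[symmetric]
        ones_mult_laplacian LN)
  have XJ: "X ** ?J = 0"
    by (simp add: X_def matrix_diff_rdistrib scalar_matrix_assoc[symmetric] NJ JJ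
        power2_eq_square)
  have "is_moore_penrose ?L X"
    unfolding is_moore_penrose_def
  proof (intro conjI)
    show "?L ** X ** ?L = ?L"
      by (simp add: LX matrix_diff_rdistrib scalar_matrix_assoc[symmetric] ones_mult_laplacian)
    have "X ** ?L ** X = X ** ?Q" by (simp add: LX matrix_mul_assoc[symmetric])
    also have "\<dots> = X"
      by (simp add: matrix_diff_ldistrib matrix_scalar_ac scalar_matrix_assoc[symmetric] XJ)
    finally show "X ** ?L ** X = X" .
    have "transpose ?Q = ?Q"
      by (simp add: vec_eq_iff transpose_def mat_def ones_matrix_def)
    then show "transpose (?L ** X) = ?L ** X" "transpose (X ** ?L) = X ** ?L"
      by (simp_all add: LX XL)
  qed
  then have "pinv ?L = X" by (rule pinv_eqI)
  with LX XL show "?L ** pinv ?L = ?Q" "pinv ?L ** ?L = ?Q" by auto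
qed

section \<open>The inner product and the Riemannian gradient\<close>

lemma ones_matrix_mult_zero_sum: "f \<in> zero_sum \<Longrightarrow> ones_matrix *v f = 0"
  by (simp add: vec_eq_iff ones_matrix_mult_component zero_sum_def)

lemma laplacian_mult_zero_sum: "laplacian E w *v h \<in> zero_sum"
  by (simp add: zero_sum_def sum_laplacian_mult)

lemma symmetric_matrix_inner:
  fixes A :: "real^'n^'n"
  assumes "transpose A = A"
  shows "(A *v x) \<bullet> y = x \<bullet> (A *v y)"
  using assms by (metis dot_lmul_matrix transpose_matrix_vector)

text \<open>\<open>L\<^sup>\<dagger> L h\<close> differs from \<open>h\<close> by a constant vector,
  to which \<open>f\<close> is orthogonal.\<close>

lemma pinv_inner_laplacian_right:
  fixes E :: "'v::finite set set"
  assumes "weighted_graph E w" "connected_graph E" "f \<in> zero_sum"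
  shows "pinv_inner E w f (laplacian E w *v h) = f \<bullet> h"
proof -
  have "f \<bullet> (ones_matrix *v h) = 0"
    using symmetric_matrix_inner[OF transpose_ones_matrix, of f h]
    by (simp add: ones_matrix_mult_zero_sum[OF assms(3)])
  then show ?thesis
    by (simp add: pinv_inner_def matrix_vector_mul_assoc pinv_laplacian[OF assms(1,2)]
        matrix_vector_mult_diff_rdistrib scaleR_matrix_vector_assoc[symmetric] inner_diff_right)
qed

text \<open>Symmetry moves \<open>L\<close> to the second argument, where
  \<open>L L\<^sup>\<dagger>\<close> fixes the zero-sum vector \<open>g\<close>.\<close>

lemma pinv_inner_laplacian_left:
  fixes E :: "'v::finite set set"
  assumes "weighted_graph E w" "connected_graph E" "g \<in> zero_sum"
  shows "pinv_inner E w (laplacian E w *v h) g = h \<bullet> g"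
  unfolding pinv_inner_def symmetric_matrix_inner[OF laplacian_symmetric]
  by (simp add: matrix_vector_mul_assoc pinv_laplacian[OF assms(1,2)]
      matrix_vector_mult_diff_rdistrib scaleR_matrix_vector_assoc[symmetric]
      ones_matrix_mult_zero_sum[OF assms(3)])

text \<open>Converts a Euclidean representative \<open>h\<close> of the differential on zero-sum
  directions into the Riemannian gradient; adding a constant to \<open>h\<close> changes neither
  side.\<close>

lemma riem_gradient_eqI:
  assumes G: "weighted_graph E w" "connected_graph E"
    and D: "\<And>f. f \<in> zero_sum \<Longrightarrow>
      ((\<lambda>t. F (\<rho> + t *\<^sub>R f)) has_real_derivative f \<bullet> h) (at 0)"
  shows "riem_gradient E w F \<rho> = laplacian E w *v h"
  unfolding riem_gradient_def
proof (rule the_equality, intro conjI ballI)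
  show "laplacian E w *v h \<in> zero_sum" by (rule laplacian_mult_zero_sum)
  show "((\<lambda>t. F (\<rho> + t *\<^sub>R f)) has_real_derivative
      pinv_inner E w f (laplacian E w *v h)) (at 0)" if "f \<in> zero_sum" for f
    using D[OF that] by (simp add: pinv_inner_laplacian_right[OF G that])
next
  fix g
  assume g: "g \<in> zero_sum \<and> (\<forall>f\<in>zero_sum.
    ((\<lambda>t. F (\<rho> + t *\<^sub>R f)) has_real_derivative pinv_inner E w f g) (at 0))"
  define k where "k = g - laplacian E w *v h"
  have k: "k \<in> zero_sum"
    using g by (simp add: k_def zero_sum_def sum_subtractf sum_laplacian_mult)
  \<comment> \<open>Testing a second candidate \<open>g\<close> in the direction \<open>L k\<close>
    turns the pseudoinverse pairing into the Euclidean one, so the difference \<open>k\<close> is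
    orthogonal to itself.\<close>
  let ?f = "laplacian E w *v k"
  have "pinv_inner E w ?f g = ?f \<bullet> h"
    using g D[OF laplacian_mult_zero_sum] laplacian_mult_zero_sum by (metis DERIV_unique)
  then have "k \<bullet> g = k \<bullet> (laplacian E w *v h)"
    using g by (simp add: pinv_inner_laplacian_left[OF G]
        symmetric_matrix_inner[OF laplacian_symmetric])
  then have "k \<bullet> k = 0" by (simp add: k_def inner_diff_right)
  then show "g = laplacian E w *v h" by (simp add: k_def)
qed

section \<open>The random walk and its stationary distribution\<close>

lemma transition_matrix_component:
  assumes "weighted_graph E w" "connected_graph E"
  shows "transition_matrix E w $ x $ y = adjacency_matrix E w $ x $ y / degree E w x"
proof -
  let ?B = "\<chi> x y. if x = y then 1 / degree E w x else 0"
  have d: "degree E w x \<noteq> 0" for x using degree_pos[OF assms, of x] by simp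
  have "matrix_inv (degree_matrix E w) = ?B"
    by (rule matrix_inv_eqI)
      (simp_all add: vec_eq_iff matrix_matrix_mult_def degree_matrix_def mat_def d
        mult_delta_left)
  then show ?thesis
    by (simp add: transition_matrix_def matrix_matrix_mult_def mult_delta_left)
qed

text \<open>As \<open>A\<close> is symmetric, \<open>P\<^sup>T = A D\<^sup>-\<^sup>1\<close>, and so
  \<open>P\<^sup>T - 1 = - (D - A) D\<^sup>-\<^sup>1\<close>.\<close>

lemma random_walk_generator:
  assumes "weighted_graph E w" "connected_graph E"
  shows "(transpose (transition_matrix E w) - mat 1) *v \<rho>
    = - (laplacian E w *v (\<chi> x. \<rho> $ x / degree E w x))"
proof -
  have d: "degree E w x \<noteq> 0" for x using degree_pos[OF assms, of x] by simp
  have "(transpose (transition_matrix E w) *v \<rho>) $ x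
      = (\<Sum>y\<in>UNIV. adjacency_matrix E w $ x $ y * (\<rho> $ y / degree E w y))" for x
    unfolding matrix_vector_mult_def
    by (simp add: transpose_def transition_matrix_component[OF assms] adjacency_symmetric[of E w x])
  then show ?thesis
    by (simp add: vec_eq_iff laplacian_def matrix_vector_mult_diff_rdistrib
        degree_matrix_mult_component adjacency_matrix_mult_component d
        del: transpose_matrix_vector)
qed

text \<open>Stationarity says that \<open>D\<^sup>-\<^sup>1 p\<close> is harmonic, hence constant;
  total mass one fixes the constant as \<open>1 / Vol\<close>.\<close>

lemma stationary_distribution_eq:
  assumes G: "weighted_graph E w" "connected_graph E"
    and p: "stationary_distribution (transition_matrix E w) p"
  shows "p $ x = degree E w x / Vol E w"
proof -
  let ?h = "\<chi> x. p $ x / degree E w x"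
  have "laplacian E w *v ?h = 0"
    using p random_walk_generator[OF G, of p]
    by (simp add: stationary_distribution_def matrix_vector_mult_diff_rdistrib)
  then have "?h $ y = ?h $ x" for y by (rule harmonic_imp_constant[OF G])
  from this[simplified] have c: "p $ y = (p $ x / degree E w x) * degree E w y" for y
    using degree_pos[OF G, of y] by (metis less_irrefl nonzero_eq_divide_eq)
  have "1 = (\<Sum>y\<in>UNIV. p $ y)"
    using p by (simp add: stationary_distribution_def prob_simplex_def)
  also have "\<dots> = (\<Sum>y\<in>UNIV. (p $ x / degree E w x) * degree E w y)"
    by (intro sum.cong refl c)
  also have "\<dots> = (p $ x / degree E w x) * Vol E w"
    by (simp add: Vol_def sum_distrib_left)
  finally show ?thesis using degree_pos[OF G, of x] Vol_pos[OF G] by (simp add: field_simps)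
qed

section \<open>The differential of \<open>chi2\<close> and the gradient flow\<close>

lemma chi2_directional_derivative:
  assumes G: "weighted_graph E w" "connected_graph E"
    and p: "stationary_distribution (transition_matrix E w) p"
    and f: "f \<in> zero_sum"
  shows "((\<lambda>t. chi2 E w p (\<rho> + t *\<^sub>R f)) has_real_derivative
    f \<bullet> (\<chi> x. \<rho> $ x / degree E w x)) (at 0)"
proof -
  note pe = stationary_distribution_eq[OF G p]
  have d: "degree E w x \<noteq> 0" for x using degree_pos[OF G, of x] by simp
  have V: "Vol E w \<noteq> 0" using Vol_pos[OF G] by simp
  have "((\<lambda>t. ((\<rho> + t *\<^sub>R f) $ x - p $ x)\<^sup>2 / p $ x) has_real_derivative
    2 * (\<rho> $ x - p $ x) * f $ x / p $ x) (at 0)" for x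
    unfolding vector_add_component vector_scaleR_component using pe[of x] d[of x] V
    by (auto intro!: derivative_eq_intros)
  then have "((\<lambda>t. chi2 E w p (\<rho> + t *\<^sub>R f)) has_real_derivative
    1 / (2 * Vol E w) * (\<Sum>x\<in>UNIV. 2 * (\<rho> $ x - p $ x) * f $ x / p $ x)) (at 0)"
    unfolding chi2_def by (intro DERIV_cmult DERIV_sum)
  \<comment> \<open>Because \<open>Vol * p x = degree x\<close>, the prefactor cancels exactly. The
    contribution of \<open>p\<close> becomes a multiple of the sum of \<open>f\<close>, which
    vanishes.\<close>
  also have "1 / (2 * Vol E w) * (\<Sum>x\<in>UNIV. 2 * (\<rho> $ x - p $ x) * f $ x / p $ x)
    = (\<Sum>x\<in>UNIV. f $ x * (\<rho> $ x / degree E w x) - f $ x / Vol E w)"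
    unfolding sum_distrib_left
    by (intro sum.cong refl) (simp add: pe d V field_simps)
  also have "\<dots> = f \<bullet> (\<chi> x. \<rho> $ x / degree E w x)"
    using f by (simp add: sum_subtractf sum_divide_distrib[symmetric] zero_sum_def inner_vec_def)
  finally show ?thesis .
qed

theorem theorem1p6:
  fixes E :: "'v::finite set set"
    and w :: "'v set \<Rightarrow> real"
    and p :: "real^'v"
  assumes "weighted_graph E w"
    and "connected_graph E"
    and "stationary_distribution (transition_matrix E w) p"
  shows "(\<forall>\<rho>\<in>pos_simplex.
            - riem_gradient E w (chi2 E w p) \<rho> = (transpose (transition_matrix E w) - mat 1) *v \<rho>)
       \<and> (\<forall>J \<rho>. is_interval J \<longrightarrow>
            (gradient_flow_trajectory E w (chi2 E w p) J \<rho> \<longleftrightarrow>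
               \<rho> ` J \<subseteq> pos_simplex \<and>
               (\<forall>t\<in>J. (\<rho> has_vector_derivative
                   (transpose (transition_matrix E w) - mat 1) *v \<rho> t) (at t within J))))"
proof -
  let ?Q = "transpose (transition_matrix E w) - mat 1"
  \<comment> \<open>Stated for every vector, so that it can be rewritten under the quantifier over
    time in the definition of a trajectory.\<close>
  have grad: "- riem_gradient E w (chi2 E w p) \<rho> = ?Q *v \<rho>" for \<rho>
    unfolding random_walk_generator[OF assms(1,2)]
    by (simp add: riem_gradient_eqI[OF assms(1,2) chi2_directional_derivative[OF assms]])
  \<comment> \<open>Regularity comes from the equation itself: a solution is continuous, and its
    derivative is a fixed linear image of it.\<close>
  have C1: "C1_curve_on J \<rho>"
    if D: "\<forall>t\<in>J. (\<rho> has_vector_derivative ?Q *v \<rho> t) (at t within J)" for J \<rho>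
  proof -
    have "continuous_on J \<rho>"
      by (rule continuous_on_vector_derivative[where f' = "\<lambda>t. ?Q *v \<rho> t"]) (use D in blast)
    then have "continuous_on J (\<lambda>t. ?Q *v \<rho> t)"
      by (rule bounded_linear.continuous_on[OF matrix_vector_mul_bounded_linear])
    with D show ?thesis
      unfolding C1_curve_on_def by (intro exI[of _ "\<lambda>t. ?Q *v \<rho> t"] conjI)
  qed
  show ?thesis
    unfolding gradient_flow_trajectory_def grad
    by (intro conjI ballI allI impI iffI refl) (auto simp only: intro: C1)
qed

end
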